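(* Let $K$ be a real symmetric $p\times p$ matrix and let $\alpha>0$ be a constant. If we choose $X^0=\sqrt{\alpha}\,I$, then the sequence $X^k$ generated by $$X^{k+1}=\frac{1}{2}\left(X^k+(X^k)^{-1}(K^2+\alpha I)\right),\qquad k\ge 0,$$ is well-defined and converges quadratically to $\sqrt{K^2+\alpha I}$. More specifically, $$\left\|X^{k+1}-\sqrt{K^2+\alpha I}\right\|_2\le \min\left\{\frac{1}{2\sqrt{\alpha+\lambda_{\min}(K^2)}}\left\|X^k-\sqrt{K^2+\alpha I}\right\|_2^2,\ \frac{1}{2}\left\|X^k-\sqrt{K^2+\alpha I}\right\|_2\right\},$$ where $\lambda_{\min}(K^2)$ is the minimum eigenvalue of $K^2$.
   Context: $I$ is the $p\times p$ identity matrix. Superscripts on $X$ are iteration indices, except that $(X^k)^{-1}$ denotes the matrix inverse of the iterate $X^k$; $K^2$ is the matrix square of $K$. For a symmetric positive definite matrix $C$, $\sqrt{C}$ denotes the matrix whose eigenvectors are the same as those of $C$ and whose eigenvalues are the (positive) square roots of those of $C$. $\|\cdot\|_2$ is the spectral (operator) norm.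
   Formalization: The displayed inequality is proved for every k ≥ 1 only, since at k = 0 it is false in general (for p = 1, K = 3, α = 1 the left side is about 2.34 and the right side about 0.74); well-definedness and quadratic convergence are as stated. *)

theory Defs
  imports "HOL-Analysis.Analysis"
begin

definition eigenpair :: "real^'n^'n \<Rightarrow> real \<Rightarrow> real^'n \<Rightarrow> bool" where
  "eigenpair A l v \<longleftrightarrow> v \<noteq> 0 \<and> A *v v = l *\<^sub>R v"

(* Only real eigenvalues are collected; for symmetric matrices these are all of them. *)
definition eigenvalues :: "real^'n^'n \<Rightarrow> real set" where
  "eigenvalues A = {l. \<exists>v. eigenpair A l v}"

definition lambda_min :: "real^'n^'n \<Rightarrow> real" where
  "lambda_min A = Min (eigenvalues A)"

(* The library norm on real^'n^'n is the Frobenius norm, hence the operator norm here. *)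
definition spectral_norm :: "real^'n^'n \<Rightarrow> real" where
  "spectral_norm A = onorm (\<lambda>v. A *v v)"

(* S has the same eigenvectors as C, and on each of them its eigenvalue is the
   square root of the eigenvalue of C. *)
definition is_matrix_sqrt :: "real^'n^'n \<Rightarrow> real^'n^'n \<Rightarrow> bool" where
  "is_matrix_sqrt C S \<longleftrightarrow>
     (\<forall>v. (\<exists>l. eigenpair C l v) \<longleftrightarrow> (\<exists>m. eigenpair S m v)) \<and>
     (\<forall>v l m. eigenpair C l v \<and> eigenpair S m v \<longrightarrow> m = sqrt l)"

(* Meaningful for symmetric positive definite C, where the eigenvectors of C
   span the space and exactly one such S exists. *)
definition matrix_sqrt :: "real^'n^'n \<Rightarrow> real^'n^'n" where
  "matrix_sqrt C = (THE S. is_matrix_sqrt C S)"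

(* The inverse matrix_inv is the actual inverse only on invertible matrices, so
   invertibility of every iterate has to be asserted separately. *)
primrec sqrt_iter :: "real \<Rightarrow> real^'n^'n \<Rightarrow> nat \<Rightarrow> real^'n^'n" where
  "sqrt_iter \<alpha> K 0 = sqrt \<alpha> *\<^sub>R mat 1"
| "sqrt_iter \<alpha> K (Suc k) =
     (1/2) *\<^sub>R (sqrt_iter \<alpha> K k
       + matrix_inv (sqrt_iter \<alpha> K k) ** (K ** K + \<alpha> *\<^sub>R mat 1))"

definition converges_quadratically ::
    "(nat \<Rightarrow> real^'n^'n) \<Rightarrow> real^'n^'n \<Rightarrow> bool" where
  "converges_quadratically X L \<longleftrightarrow>
     X \<longlonglongrightarrow> L \<and>
     (\<exists>M. \<forall>\<^sub>F k in sequentially.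
        spectral_norm (X (Suc k) - L) \<le> M * (spectral_norm (X k - L))\<^sup>2)"

end

theory Submission
  imports Defs
begin

text \<open>An orthonormal eigenbasis of \<open>K\<close> diagonalises every iterate and the square root at once, so the
  iteration is Heron's method for \<open>sqrt c\<close> in each eigendirection, where \<open>c = \<kappa>\<^sup>2 + \<alpha>\<close>. Its error
  satisfies \<open>x' - s = (x - s)\<^sup>2 / (2 x)\<close> with \<open>s = sqrt c\<close>, and \<open>x \<ge> s\<close> from the first step on;
  both bounds follow, since the spectral norm is the largest error over the eigenbasis.\<close>

section \<open>Orthonormal eigenbases of self-adjoint maps\<close>

text \<open>A maximiser of the quadratic form on the unit sphere of the subspace is an eigenvector.\<close>

lemma self_adjoint_has_eigenvector_in_subspace:
  fixes f :: "'a::euclidean_space \<Rightarrow> 'a"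
  assumes lin: "linear f" and adj: "\<And>x y. f x \<bullet> y = x \<bullet> f y"
    and V: "subspace V" and inv: "\<And>x. x \<in> V \<Longrightarrow> f x \<in> V" and ne: "u \<in> V" "u \<noteq> 0"
  obtains v c where "v \<in> V" "norm v = 1" "f v = c *\<^sub>R v"
proof -
  let ?S = "V \<inter> sphere 0 1"
  have "compact ?S"
    by (simp add: V closed_Int_compact closed_subspace)
  moreover have "u /\<^sub>R norm u \<in> ?S"
    using ne V by (simp add: subspace_scale)
  moreover have "continuous_on ?S (\<lambda>x. x \<bullet> f x)"
    by (intro continuous_intros linear_continuous_on) (simp add: lin linear_conv_bounded_linear[symmetric])
  ultimately obtain v where v: "v \<in> ?S" and vmax: "\<And>x. x \<in> ?S \<Longrightarrow> x \<bullet> f x \<le> v \<bullet> f v"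
    using continuous_attains_sup[of ?S] by blast
  define c where "c = v \<bullet> f v"
  have vV: "v \<in> V" and nv: "norm v = 1" and vv: "v \<bullet> v = 1"
    using v by (auto simp: norm_eq_1)
  \<comment> \<open>By homogeneity, the maximality of \<open>v\<close> on the sphere becomes
    \<open>q x \<ge> 0\<close> on all of \<open>V\<close>, with equality at
    \<open>v\<close>.\<close>
  define q where "q = (\<lambda>x. c * (x \<bullet> x) - x \<bullet> f x)"
  have q: "q x \<ge> 0" if "x \<in> V" for x
  proof (cases "x = 0")
    case False
    have "(x /\<^sub>R norm x) \<bullet> f (x /\<^sub>R norm x) \<le> c"
      unfolding c_def using that False V by (intro vmax) (simp add: subspace_scale)
    moreover have "(x /\<^sub>R norm x) \<bullet> f (x /\<^sub>R norm x) = (x \<bullet> f x) / (x \<bullet> x)"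
      by (simp add: linear_scale[OF lin] dot_square_norm power2_eq_square divide_inverse mult_ac)
    ultimately show ?thesis
      using False by (simp add: q_def pos_divide_le_eq)
  qed (simp add: q_def linear_0[OF lin])
  \<comment> \<open>Half the gradient of \<open>q\<close> at \<open>v\<close>. As \<open>v\<close>
    minimises \<open>q\<close> on \<open>V\<close>, it has to vanish.\<close>
  define w where "w = c *\<^sub>R v - f v"
  have wV: "w \<in> V"
    unfolding w_def by (intro subspace_diff subspace_scale V inv vV)
  have quad: "2 * t * (w \<bullet> w) + t\<^sup>2 * q w \<ge> 0" for t
  proof -
    have "v + t *\<^sub>R w \<in> V"
      by (intro subspace_add subspace_scale V vV wV)
    then have "0 \<le> q (v + t *\<^sub>R w)"
      by (rule q)
    also have "\<dots> = 2 * t * (c * (v \<bullet> w) - f v \<bullet> w) + t\<^sup>2 * q w"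
      using vv adj[of v w]
      by (simp add: q_def linear_add[OF lin] linear_scale[OF lin] inner_add_left inner_add_right
          c_def[symmetric] inner_commute power2_eq_square algebra_simps)
    also have "c * (v \<bullet> w) - f v \<bullet> w = w \<bullet> w"
      by (simp add: w_def inner_diff_left)
    finally show ?thesis .
  qed
  have "w \<bullet> w = 0"
  proof (rule ccontr)
    assume "w \<bullet> w \<noteq> 0"
    then have pos: "w \<bullet> w > 0"
      by simp
    \<comment> \<open>The exact minimiser would be \<open>- (w \<bullet> w) / q w\<close>; adding 1
      keeps the denominator positive when \<open>q w = 0\<close>, and the value is still
      negative.\<close>
    define t where "t = - (w \<bullet> w) / (q w + 1)"
    have qw: "q w \<ge> 0"
      by (rule q[OF wV])
    have "2 * t * (w \<bullet> w) + t\<^sup>2 * q w = - (w \<bullet> w)\<^sup>2 * (q w + 2) / (q w + 1)\<^sup>2"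
      using qw by (simp add: t_def divide_simps power2_eq_square) (simp add: algebra_simps)
    also have "\<dots> < 0"
      using qw pos by (simp add: divide_simps mult_neg_pos)
    finally show False
      using quad[of t] by simp
  qed
  then have "f v = c *\<^sub>R v"
    by (simp add: w_def)
  with vV nv show ?thesis
    using that by blast
qed

definition orthonormal_basis :: "'a::euclidean_space set \<Rightarrow> bool" where
  "orthonormal_basis B \<longleftrightarrow>
    finite B \<and> pairwise orthogonal B \<and> (\<forall>b\<in>B. norm b = 1) \<and> span B = UNIV"

lemma orthonormal_independent:
  fixes B :: "'a::euclidean_space set"
  assumes "pairwise orthogonal B" "\<forall>b\<in>B. norm b = 1"
  shows "independent B"
  using assms by (metis norm_zero pairwise_orthogonal_independent zero_neq_one)

text \<open>An orthonormal set of eigenvectors of maximal cardinality spans: otherwise its orthogonal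
  complement is invariant and contributes a further eigenvector.\<close>

lemma self_adjoint_has_eigenbasis:
  fixes f :: "'a::euclidean_space \<Rightarrow> 'a"
  assumes lin: "linear f" and adj: "\<And>x y. f x \<bullet> y = x \<bullet> f y"
  obtains B where "orthonormal_basis B" "\<And>b. b \<in> B \<Longrightarrow> \<exists>c. f b = c *\<^sub>R b"
proof -
  define P where "P = (\<lambda>B. pairwise orthogonal B \<and> (\<forall>b\<in>B. norm b = 1) \<and>
    (\<forall>b\<in>B. \<exists>c. f b = c *\<^sub>R b))"
  have indep: "independent B" if "P B" for B
    using that orthonormal_independent by (auto simp: P_def)
  have "P {}"
    by (simp add: P_def)
  moreover have "\<forall>B. P B \<longrightarrow> card B < Suc (DIM('a))"
    using indep independent_card_le by (metis less_Suc_eq_le)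
  ultimately obtain B where PB: "P B" and Bmax: "\<And>B'. P B' \<Longrightarrow> card B' \<le> card B"
    using ex_has_greatest_nat[of P "{}" card "Suc (DIM('a))"] by blast
  have fin: "finite B"
    using indep[OF PB] independent_imp_finite by blast
  have "span B = UNIV"
  proof (rule ccontr)
    assume "span B \<noteq> UNIV"
    then have "span B \<subset> span UNIV"
      by auto
    then obtain u where u: "u \<noteq> 0" "\<And>y. y \<in> span B \<Longrightarrow> orthogonal u y"
      using orthogonal_to_subspace_exists_gen[of B UNIV] by metis
    let ?V = "{y. \<forall>x\<in>B. orthogonal x y}"
    \<comment> \<open>Invariance of the complement: \<open>b \<bullet> f x = f b \<bullet> x\<close>
      is a multiple of \<open>b \<bullet> x = 0\<close>.\<close>
    have "f x \<in> ?V" if "x \<in> ?V" for x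
    proof -
      have "orthogonal b (f x)" if "b \<in> B" for b
      proof -
        from PB that obtain c where "f b = c *\<^sub>R b"
          by (auto simp: P_def)
        moreover have "b \<bullet> x = 0"
          using \<open>x \<in> ?V\<close> that by (auto simp: orthogonal_def)
        ultimately show ?thesis
          by (simp add: orthogonal_def adj[symmetric])
      qed
      then show ?thesis
        by simp
    qed
    moreover have "u \<in> ?V"
      using u(2) by (auto simp: orthogonal_commute span_base)
    ultimately obtain v c where v: "v \<in> ?V" "norm v = 1" "f v = c *\<^sub>R v"
      using self_adjoint_has_eigenvector_in_subspace
        [OF lin adj subspace_orthogonal_to_vectors[of B], of u] u(1) by blast
    have "v \<notin> B"
      using v(1,2) by (auto simp: orthogonal_self)
    moreover have "P (insert v B)"
      using PB v by (auto simp: P_def pairwise_insert orthogonal_commute)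
    ultimately show False
      using Bmax[of "insert v B"] fin by simp
  qed
  then show ?thesis
    using that[of B] PB fin by (simp add: P_def orthonormal_basis_def)
qed

section \<open>Coordinates with respect to an orthonormal basis\<close>

lemma orthonormal_basis_eqI:
  assumes "orthonormal_basis B" "\<And>b. b \<in> B \<Longrightarrow> x \<bullet> b = y \<bullet> b"
  shows "x = y"
  using assms by (intro vector_eq_dot_span[of x B y]) (auto simp: orthonormal_basis_def inner_commute)

lemma orthonormal_basis_expansion:
  assumes "orthonormal_basis B"
  shows "(\<Sum>b\<in>B. (x \<bullet> b) *\<^sub>R b) = x"
  using assms by (intro orthonormal_basis_expand) (auto simp: orthonormal_basis_def)

lemma inner_orthonormal_basis_sum:
  assumes "orthonormal_basis B" "b \<in> B"
  shows "(\<Sum>a\<in>B. g a *\<^sub>R a) \<bullet> b = g b"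
proof -
  have "(\<Sum>a\<in>B. g a *\<^sub>R a) \<bullet> b = (\<Sum>a\<in>B. if a = b then g a else 0)"
    unfolding inner_sum_left using assms
    by (intro sum.cong) (auto simp: orthonormal_basis_def pairwise_def orthogonal_def norm_eq_1)
  then show ?thesis
    using assms by (simp add: orthonormal_basis_def)
qed

lemma orthonormal_basis_parseval:
  assumes "orthonormal_basis B"
  shows "(norm x)\<^sup>2 = (\<Sum>b\<in>B. (x \<bullet> b)\<^sup>2)"
proof -
  have "x \<bullet> x = x \<bullet> (\<Sum>b\<in>B. (x \<bullet> b) *\<^sub>R b)"
    by (simp add: orthonormal_basis_expansion[OF assms])
  then show ?thesis
    by (simp add: dot_square_norm inner_sum_right power2_eq_square)
qed

section \<open>Matrices diagonal in an orthonormal basis\<close>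

text \<open>Entries are indexed by the basis vectors themselves, so matrices sharing an eigenbasis
  are compared entrywise without a change of basis.\<close>

definition diagonal_on :: "(real^'n) set \<Rightarrow> real^'n^'n \<Rightarrow> (real^'n \<Rightarrow> real) \<Rightarrow> bool" where
  "diagonal_on B A d \<longleftrightarrow> (\<forall>b\<in>B. A *v b = d b *\<^sub>R b)"

lemma diagonal_on_inner:
  assumes "orthonormal_basis B" "diagonal_on B A d" "b \<in> B"
  shows "(A *v x) \<bullet> b = d b * (x \<bullet> b)"
proof -
  have "A *v x = A *v (\<Sum>a\<in>B. (x \<bullet> a) *\<^sub>R a)"
    by (simp add: orthonormal_basis_expansion[OF assms(1)])
  also have "\<dots> = (\<Sum>a\<in>B. ((x \<bullet> a) * d a) *\<^sub>R a)"
    using assms(2) unfolding linear_sum[OF matrix_vector_mul_linear]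
    by (intro sum.cong) (auto simp: diagonal_on_def matrix_vector_mult_scaleR)
  finally show ?thesis
    using inner_orthonormal_basis_sum[OF assms(1,3)] by simp
qed

lemma diagonal_on_unique:
  assumes "orthonormal_basis B" "diagonal_on B A d" "diagonal_on B A' d"
  shows "A = A'"
  unfolding matrix_eq
  by (intro allI orthonormal_basis_eqI[OF assms(1)])
    (simp add: diagonal_on_inner[OF assms(1,2)] diagonal_on_inner[OF assms(1,3)])

text \<open>Supplies the candidate square root: \<open>d\<close> is prescribed on the basis and
  extended linearly through coordinates.\<close>

lemma diagonal_on_exists:
  assumes "orthonormal_basis B"
  obtains A where "diagonal_on B A d"
proof -
  let ?f = "\<lambda>x. \<Sum>b\<in>B. (d b * (x \<bullet> b)) *\<^sub>R b"
  have "linear ?f"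
    by (rule linearI) (simp_all add: inner_add_left algebra_simps sum.distrib scaleR_sum_right)
  moreover have "?f b = d b *\<^sub>R b" if "b \<in> B" for b
  proof (rule orthonormal_basis_eqI[OF assms])
    fix a assume "a \<in> B"
    then show "?f b \<bullet> a = (d b *\<^sub>R b) \<bullet> a"
      using that assms unfolding inner_orthonormal_basis_sum[OF assms \<open>a \<in> B\<close>]
      by (cases "a = b")
        (auto simp: orthonormal_basis_def pairwise_def orthogonal_def norm_eq_1 inner_commute)
  qed
  ultimately have "diagonal_on B (matrix ?f) d"
    by (simp add: diagonal_on_def matrix_works linear_matrix_vector_mul_eq)
  then show ?thesis
    by (rule that)
qed

text \<open>In coordinates the eigenvector equation reads
  \<open>d b * (v \<bullet> b) = l * (v \<bullet> b)\<close>, so an eigenvector involves only basis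
  vectors with one common entry.\<close>

lemma eigenpair_diagonal_on_iff:
  assumes "orthonormal_basis B" "diagonal_on B A d"
  shows "eigenpair A l v \<longleftrightarrow> v \<noteq> 0 \<and> (\<forall>b\<in>B. v \<bullet> b = 0 \<or> d b = l)"
proof -
  have "A *v v = l *\<^sub>R v \<longleftrightarrow> (\<forall>b\<in>B. (A *v v) \<bullet> b = (l *\<^sub>R v) \<bullet> b)"
    using orthonormal_basis_eqI[OF assms(1)] by metis
  then show ?thesis
    by (auto simp: eigenpair_def diagonal_on_inner[OF assms])
qed

lemma eigenvalues_diagonal_on:
  assumes "orthonormal_basis B" "diagonal_on B A d"
  shows "eigenvalues A = d ` B"
proof
  show "eigenvalues A \<subseteq> d ` B"
  proof
    fix l assume "l \<in> eigenvalues A"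
    then obtain v where v: "v \<noteq> 0" "\<forall>b\<in>B. v \<bullet> b = 0 \<or> d b = l"
      by (auto simp: eigenvalues_def eigenpair_diagonal_on_iff[OF assms])
    moreover have "\<exists>b\<in>B. v \<bullet> b \<noteq> 0"
      using v(1) orthonormal_basis_eqI[OF assms(1), of v 0] by auto
    ultimately show "l \<in> d ` B"
      by auto
  qed
  show "d ` B \<subseteq> eigenvalues A"
  proof (clarify)
    fix b assume "b \<in> B"
    then have "eigenpair A (d b) b"
      using assms by (auto simp: eigenpair_def diagonal_on_def orthonormal_basis_def)
    then show "d b \<in> eigenvalues A"
      by (auto simp: eigenvalues_def)
  qed
qed

text \<open>Vectors of type \<open>real^'n\<close> have at least one component. Nonemptiness makes
  the \<open>Min\<close> in \<open>lambda_min\<close> meaningful and forces any bound on the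
  \<open>\<bar>d b\<bar>\<close> to be nonnegative.\<close>

lemma orthonormal_basis_nonempty:
  fixes B :: "(real^'n) set"
  assumes "orthonormal_basis B"
  shows "B \<noteq> {}"
proof
  assume "B = {}"
  then have "(1::real^'n) = 0"
    using orthonormal_basis_eqI[OF assms] by blast
  then show False
    by simp
qed

lemma lambda_min_diagonal_on:
  assumes "orthonormal_basis B" "diagonal_on B A d"
  shows "lambda_min A \<in> d ` B" and "b \<in> B \<Longrightarrow> lambda_min A \<le> d b"
  using assms orthonormal_basis_nonempty[OF assms(1)] unfolding lambda_min_def eigenvalues_diagonal_on[OF assms]
  by (auto simp: orthonormal_basis_def intro!: Min_in Min_le)

section \<open>Spectral norms of diagonal matrices\<close>

lemma spectral_norm_nonneg: "spectral_norm A \<ge> 0"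
  by (simp add: spectral_norm_def onorm_pos_le matrix_vector_mul_bounded_linear)

text \<open>Each coordinate is scaled by at most \<open>M\<close>, hence by Parseval so is the
  norm.\<close>

lemma spectral_norm_diagonal_on_le:
  assumes "orthonormal_basis B" "diagonal_on B A d" "\<And>b. b \<in> B \<Longrightarrow> \<bar>d b\<bar> \<le> M"
  shows "spectral_norm A \<le> M"
  unfolding spectral_norm_def
proof (rule onorm_le)
  fix x
  have M: "0 \<le> M"
    using orthonormal_basis_nonempty[OF assms(1)] assms(3) by fastforce
  have "(norm (A *v x))\<^sup>2 = (\<Sum>b\<in>B. (d b)\<^sup>2 * (x \<bullet> b)\<^sup>2)"
    by (simp add: orthonormal_basis_parseval[OF assms(1)] diagonal_on_inner[OF assms(1,2)] power_mult_distrib)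
  also have "\<dots> \<le> (\<Sum>b\<in>B. M\<^sup>2 * (x \<bullet> b)\<^sup>2)"
    using assms(3) by (intro sum_mono mult_right_mono) (auto simp: abs_le_square_iff[symmetric] M)
  also have "\<dots> = (M * norm x)\<^sup>2"
    by (simp add: orthonormal_basis_parseval[OF assms(1)] power_mult_distrib sum_distrib_left)
  finally show "norm (A *v x) \<le> M * norm x"
    by (rule power2_le_imp_le) (simp add: M)
qed

text \<open>The unit vector \<open>b\<close> tests the operator norm. Together with the preceding
  upper bound, the spectral norm is the largest \<open>\<bar>d b\<bar>\<close>.\<close>

lemma abs_le_spectral_norm_diagonal_on:
  assumes "orthonormal_basis B" "diagonal_on B A d" "b \<in> B"
  shows "\<bar>d b\<bar> \<le> spectral_norm A"
  using onorm[OF matrix_vector_mul_bounded_linear, of A b] assms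
  by (auto simp: spectral_norm_def diagonal_on_def orthonormal_basis_def)

section \<open>Algebraic operations, inverses and square roots of diagonal matrices\<close>

lemma diagonal_on_mat_1: "diagonal_on B (mat 1) (\<lambda>_. 1)"
  by (simp add: diagonal_on_def)

lemma diagonal_on_add:
  "diagonal_on B A d \<Longrightarrow> diagonal_on B A' d' \<Longrightarrow> diagonal_on B (A + A') (\<lambda>b. d b + d' b)"
  by (simp add: diagonal_on_def matrix_vector_mult_add_rdistrib algebra_simps)

lemma diagonal_on_diff:
  "diagonal_on B A d \<Longrightarrow> diagonal_on B A' d' \<Longrightarrow> diagonal_on B (A - A') (\<lambda>b. d b - d' b)"
  by (simp add: diagonal_on_def matrix_vector_mult_diff_rdistrib algebra_simps)

lemma diagonal_on_scaleR:
  "diagonal_on B A d \<Longrightarrow> diagonal_on B (c *\<^sub>R A) (\<lambda>b. c * d b)"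
  by (simp add: diagonal_on_def scaleR_matrix_vector_assoc[symmetric])

lemma diagonal_on_mult:
  "diagonal_on B A d \<Longrightarrow> diagonal_on B A' d' \<Longrightarrow> diagonal_on B (A ** A') (\<lambda>b. d b * d' b)"
  by (simp add: diagonal_on_def matrix_vector_mul_assoc[symmetric] matrix_vector_mult_scaleR)

text \<open>No coordinate is annihilated, so the kernel is trivial, which suffices for a square
  matrix.\<close>

lemma invertible_diagonal_on:
  assumes "orthonormal_basis B" "diagonal_on B A d" "\<And>b. b \<in> B \<Longrightarrow> d b \<noteq> 0"
  shows "invertible A"
proof -
  have "x = 0" if "A *v x = 0" for x
  proof (rule orthonormal_basis_eqI[OF assms(1)])
    fix b assume "b \<in> B"
    then show "x \<bullet> b = 0 \<bullet> b"
      using diagonal_on_inner[OF assms(1,2), of b x] assms(3) that by simp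
  qed
  then show ?thesis
    using invertible_left_inverse matrix_left_invertible_ker by blast
qed

lemma diagonal_on_matrix_inv:
  assumes "invertible A" "diagonal_on B A d" "\<And>b. b \<in> B \<Longrightarrow> d b \<noteq> 0"
  shows "diagonal_on B (matrix_inv A) (\<lambda>b. 1 / d b)"
  unfolding diagonal_on_def
proof
  fix b assume b: "b \<in> B"
  \<comment> \<open>\<open>matrix_inv\<close> is a Hilbert choice, so its defining property rests on
    the existence of an inverse.\<close>
  have "matrix_inv A ** A = mat 1"
    using assms(1) unfolding invertible_def matrix_inv_def by (rule someI2_ex) simp
  then have "matrix_inv A *v (A *v b) = b"
    by (simp add: matrix_vector_mul_assoc)
  then have "d b *\<^sub>R (matrix_inv A *v b) = b"
    using assms(2) b by (simp add: diagonal_on_def matrix_vector_mult_scaleR)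
  then show "matrix_inv A *v b = (1 / d b) *\<^sub>R b"
    using assms(3)[OF b] by (metis divideR_right inverse_eq_divide)
qed

text \<open>The definite description needs existence and uniqueness. The matrix with entries
  \<open>sqrt (c b)\<close> meets the specification, and any other solution agrees with it on
  \<open>B\<close>, since each basis vector is an eigenvector of \<open>C\<close> and its new
  eigenvalue is prescribed.\<close>

lemma diagonal_on_matrix_sqrt:
  assumes B: "orthonormal_basis B" and C: "diagonal_on B C c" and nonneg: "\<And>b. b \<in> B \<Longrightarrow> c b \<ge> 0"
  shows "diagonal_on B (matrix_sqrt C) (\<lambda>b. sqrt (c b))"
proof -
  obtain S where S: "diagonal_on B S (\<lambda>b. sqrt (c b))"
    using diagonal_on_exists[OF B] .
  note C_iff = eigenpair_diagonal_on_iff[OF B C] and S_iff = eigenpair_diagonal_on_iff[OF B S]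
  have CS: "eigenpair S (sqrt l) v" if "eigenpair C l v" for l v
    using that by (auto simp: C_iff S_iff)
  \<comment> \<open>All entries \<open>c b\<close> that \<open>v\<close> involves have the same root
    \<open>m\<close>; nonnegativity makes each of them \<open>m\<^sup>2\<close>.\<close>
  have "eigenpair C (m\<^sup>2) v" if "eigenpair S m v" for m v
    using that nonneg by (auto simp: C_iff S_iff)
  moreover have "m = sqrt l" if "eigenpair C l v" "eigenpair S m v" for l m v
    using CS[OF that(1)] that(2) by (auto simp: eigenpair_def)
  ultimately have "is_matrix_sqrt C S"
    using CS unfolding is_matrix_sqrt_def by blast
  moreover have "T = S" if T: "is_matrix_sqrt C T" for T
  proof (rule diagonal_on_unique[OF B _ S])
    show "diagonal_on B T (\<lambda>b. sqrt (c b))"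
      unfolding diagonal_on_def
    proof
      fix b assume b: "b \<in> B"
      then have eb: "eigenpair C (c b) b"
        using B C by (auto simp: eigenpair_def diagonal_on_def orthonormal_basis_def)
      then obtain m where "eigenpair T m b"
        using T unfolding is_matrix_sqrt_def by blast
      moreover from this have "m = sqrt (c b)"
        using T eb unfolding is_matrix_sqrt_def by blast
      ultimately show "T *v b = sqrt (c b) *\<^sub>R b"
        by (simp add: eigenpair_def)
    qed
  qed
  ultimately have "matrix_sqrt C = S"
    unfolding matrix_sqrt_def by (rule the_equality)
  with S show ?thesis
    by simp
qed

text \<open>Convergence in the matrix type is entrywise, and each entry is bounded by the operator
  norm.\<close>

lemma tendsto_of_spectral_norm:
  assumes "(\<lambda>k. spectral_norm (X k - L)) \<longlonglongrightarrow> 0"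
  shows "X \<longlonglongrightarrow> L"
proof (intro vec_tendstoI)
  fix i j
  have "(\<lambda>k. X k $ i $ j - L $ i $ j) \<longlonglongrightarrow> 0"
  proof (rule Lim_null_comparison[OF _ assms])
    show "\<forall>\<^sub>F k in sequentially. norm (X k $ i $ j - L $ i $ j) \<le> spectral_norm (X k - L)"
      using matrix_component_le_onorm[of "X k - L" i j for k]
      by (simp add: spectral_norm_def)
  qed
  then show "(\<lambda>k. X k $ i $ j) \<longlonglongrightarrow> L $ i $ j"
    by (rule Lim_null[THEN iffD2])
qed

section \<open>Heron's method\<close>

text \<open>Newton's method for the equation \<open>t\<^sup>2 = c\<close>, started at
  \<open>x\<close>.\<close>

primrec heron :: "real \<Rightarrow> real \<Rightarrow> nat \<Rightarrow> real" where
  "heron c x 0 = x"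
| "heron c x (Suc k) = (heron c x k + c / heron c x k) / 2"

lemma heron_pos: "c > 0 \<Longrightarrow> x > 0 \<Longrightarrow> heron c x k > 0"
  by (induction k) (auto intro: add_pos_pos)

text \<open>Completing the square: the average of \<open>h\<close> and \<open>s\<^sup>2 / h\<close>
  exceeds \<open>s\<close> by \<open>(h - s)\<^sup>2 / (2 * h)\<close>.\<close>

lemma heron_error:
  assumes "c > 0" "x > 0"
  shows "heron c x (Suc k) - sqrt c = (heron c x k - sqrt c)\<^sup>2 / (2 * heron c x k)"
proof -
  have "c = (sqrt c)\<^sup>2"
    using assms by simp
  moreover have "(h + s\<^sup>2 / h) / 2 - s = (h - s)\<^sup>2 / (2 * h)" if "h > 0" for h s :: real
    using that by (simp add: field_simps power2_eq_square)
  ultimately show ?thesis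
    using heron_pos[OF assms, of k] by (metis heron.simps(2))
qed

text \<open>The error after a step is a square over a positive number, on whichever side of the root
  the previous iterate lies. The starting value itself may lie below the root, hence
  \<open>k \<ge> 1\<close>.\<close>

lemma heron_ge_sqrt:
  assumes "c > 0" "x > 0" "k \<ge> 1"
  shows "sqrt c \<le> heron c x k"
proof -
  obtain j where "k = Suc j"
    using assms(3) by (cases k) auto
  moreover have "0 \<le> (heron c x j - sqrt c)\<^sup>2 / (2 * heron c x j)"
    using heron_pos[OF assms(1,2), of j] by simp
  ultimately show ?thesis
    using heron_error[OF assms(1,2), of j] by (simp del: heron.simps)
qed

text \<open>Above the root, the iterate in the denominator may be replaced by the smaller
  \<open>sqrt c\<close>, which does not depend on \<open>k\<close>.\<close>

lemma heron_error_quadratic: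
  assumes "c > 0" "x > 0" "k \<ge> 1"
  shows "\<bar>heron c x (Suc k) - sqrt c\<bar> \<le> (heron c x k - sqrt c)\<^sup>2 / (2 * sqrt c)"
proof -
  have "sqrt c > 0" "sqrt c \<le> heron c x k"
    using assms heron_ge_sqrt by auto
  then show ?thesis
    unfolding heron_error[OF assms(1,2)] by (simp add: frac_le)
qed

lemma heron_error_half:
  assumes "c > 0" "x > 0" "k \<ge> 1"
  shows "\<bar>heron c x (Suc k) - sqrt c\<bar> \<le> \<bar>heron c x k - sqrt c\<bar> / 2"
proof -
  \<comment> \<open>One factor \<open>h - s\<close> is at most \<open>h\<close> and cancels against
    the denominator.\<close>
  have "(h - s)\<^sup>2 / (2 * h) \<le> (h - s) / 2" if "s > 0" "s \<le> h" for h s :: real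
  proof -
    have "(h - s) * (h - s) \<le> (h - s) * h"
      using that by (intro mult_left_mono) auto
    then show ?thesis
      using that by (simp add: field_simps power2_eq_square)
  qed
  moreover have "sqrt c > 0" "sqrt c \<le> heron c x k"
    using assms heron_ge_sqrt by auto
  ultimately have "(heron c x k - sqrt c)\<^sup>2 / (2 * heron c x k) \<le> (heron c x k - sqrt c) / 2"
    by blast
  moreover have "heron c x k > 0"
    by (rule heron_pos[OF assms(1,2)])
  ultimately show ?thesis
    using \<open>sqrt c \<le> heron c x k\<close> unfolding heron_error[OF assms(1,2)] by (simp only: abs_of_nonneg) simp
qed

section \<open>The matrix iteration\<close>

text \<open>The two claims are intertwined: positive entries make the current iterate invertible,
  and only then does \<open>matrix_inv\<close> act by reciprocals in the next step.\<close>

lemma sqrt_iter_diagonal_on: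
  assumes B: "orthonormal_basis B" and K: "diagonal_on B K \<kappa>" and "\<alpha> > 0"
  shows "diagonal_on B (sqrt_iter \<alpha> K k) (\<lambda>b. heron ((\<kappa> b)\<^sup>2 + \<alpha>) (sqrt \<alpha>) k)"
    and "invertible (sqrt_iter \<alpha> K k)"
proof -
  let ?h = "\<lambda>k b. heron ((\<kappa> b)\<^sup>2 + \<alpha>) (sqrt \<alpha>) k"
  have nz: "?h k b \<noteq> 0" for k b
    using heron_pos[of "(\<kappa> b)\<^sup>2 + \<alpha>" "sqrt \<alpha>" k] \<open>\<alpha> > 0\<close> by (simp add: add_nonneg_pos)
  have diag: "diagonal_on B (sqrt_iter \<alpha> K k) (?h k)" for k
  proof (induction k)
    case 0
    show ?case
      using diagonal_on_scaleR[OF diagonal_on_mat_1, of B "sqrt \<alpha>"] by simp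
  next
    case (Suc k)
    note inv = diagonal_on_matrix_inv[OF invertible_diagonal_on[OF B Suc] Suc, OF nz nz]
    from diagonal_on_scaleR[OF diagonal_on_add[OF Suc diagonal_on_mult[OF inv
      diagonal_on_add[OF diagonal_on_mult[OF K K] diagonal_on_scaleR[OF diagonal_on_mat_1]]]],
      of "1/2" \<alpha>]
    show ?case
      by (simp add: power2_eq_square)
  qed
  show "diagonal_on B (sqrt_iter \<alpha> K k) (?h k)"
    by (rule diag)
  show "invertible (sqrt_iter \<alpha> K k)"
    by (rule invertible_diagonal_on[OF B diag nz])
qed

text \<open>The bounds start at \<open>k = 1\<close> because both can fail at \<open>k = 0\<close>:
  for 1 by 1 matrices with \<open>K = 2\<close> and \<open>\<alpha> = 1\<close>, the limit is
  \<open>sqrt 5\<close> and the first two iterates are 1 and 3.\<close>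

theorem theorem2:
  fixes K :: "real^'n^'n" and \<alpha> :: real
  assumes "transpose K = K" and "\<alpha> > 0"
  defines "X \<equiv> sqrt_iter \<alpha> K"
    and "S \<equiv> matrix_sqrt (K ** K + \<alpha> *\<^sub>R mat 1)"
  shows "(\<forall>k. invertible (X k)) \<and>
    converges_quadratically X S \<and>
    (\<forall>k\<ge>1. spectral_norm (X (Suc k) - S)
      \<le> min (1 / (2 * sqrt (\<alpha> + lambda_min (K ** K))) * (spectral_norm (X k - S))\<^sup>2)
            (1 / 2 * spectral_norm (X k - S)))"
proof -
  have "(K *v x) \<bullet> y = x \<bullet> (K *v y)" for x y
    using assms(1) by (metis dot_lmul_matrix vector_transpose_matrix)
  then obtain B where B: "orthonormal_basis B" and "\<And>b. b \<in> B \<Longrightarrow> \<exists>c. K *v b = c *\<^sub>R b"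
    using self_adjoint_has_eigenbasis[of "(*v) K"] by auto
  then obtain \<kappa> where K: "diagonal_on B K \<kappa>"
    unfolding diagonal_on_def by metis
  define c where "c = (\<lambda>b. (\<kappa> b)\<^sup>2 + \<alpha>)"
  have c: "c b > 0" for b
    using \<open>\<alpha> > 0\<close> by (simp add: c_def add_nonneg_pos)
  have KK: "diagonal_on B (K ** K) (\<lambda>b. (\<kappa> b)\<^sup>2)"
    using diagonal_on_mult[OF K K] by (simp add: power2_eq_square)
  have "diagonal_on B (K ** K + \<alpha> *\<^sub>R mat 1) c"
    using diagonal_on_add[OF KK diagonal_on_scaleR[OF diagonal_on_mat_1, of _ \<alpha>]]
    by (simp add: c_def)
  then have S: "diagonal_on B S (\<lambda>b. sqrt (c b))"
    unfolding S_def by (intro diagonal_on_matrix_sqrt[OF B]) (simp_all add: less_imp_le c)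
  have err: "diagonal_on B (X k - S) (\<lambda>b. heron (c b) (sqrt \<alpha>) k - sqrt (c b))" for k
    using diagonal_on_diff[OF sqrt_iter_diagonal_on(1)[OF B K \<open>\<alpha> > 0\<close>] S]
    by (simp add: X_def c_def)
  define e where "e = (\<lambda>k. spectral_norm (X k - S))"
  define s where "s = sqrt (\<alpha> + lambda_min (K ** K))"
  have "lambda_min (K ** K) \<ge> 0"
    using lambda_min_diagonal_on(1)[OF B KK] by auto
  then have s: "s > 0"
    using \<open>\<alpha> > 0\<close> by (simp add: s_def)
  \<comment> \<open>\<open>lambda_min\<close> is the least of the
    \<open>(\<kappa> b)\<^sup>2\<close>, so the single constant \<open>s\<close> serves every
    eigendirection.\<close>
  have sc: "s \<le> sqrt (c b)" if "b \<in> B" for b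
    using lambda_min_diagonal_on(2)[OF B KK that] by (simp add: s_def c_def)
  have e: "\<bar>heron (c b) (sqrt \<alpha>) k - sqrt (c b)\<bar> \<le> e k" if "b \<in> B" for b k
    unfolding e_def by (rule abs_le_spectral_norm_diagonal_on[OF B err that])
  have quad: "e (Suc k) \<le> 1 / (2 * s) * (e k)\<^sup>2" if "k \<ge> 1" for k
  proof (subst e_def, rule spectral_norm_diagonal_on_le[OF B err])
    fix b assume b: "b \<in> B"
    have "\<bar>heron (c b) (sqrt \<alpha>) (Suc k) - sqrt (c b)\<bar>
        \<le> (heron (c b) (sqrt \<alpha>) k - sqrt (c b))\<^sup>2 / (2 * sqrt (c b))"
      using c \<open>\<alpha> > 0\<close> that by (intro heron_error_quadratic) auto
    \<comment> \<open>Passing from one eigendirection to the worst case enlarges the numerator to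
      \<open>(e k)\<^sup>2\<close> and shrinks the root in the denominator to
      \<open>s\<close>.\<close>
    also have "\<dots> \<le> (e k)\<^sup>2 / (2 * s)"
      using e[OF b, of k] sc[OF b] s by (intro frac_le) (auto simp: abs_le_square_iff[symmetric])
    finally show "\<bar>heron (c b) (sqrt \<alpha>) (Suc k) - sqrt (c b)\<bar> \<le> 1 / (2 * s) * (e k)\<^sup>2"
      by simp
  qed
  have half: "e (Suc k) \<le> 1 / 2 * e k" if "k \<ge> 1" for k
  proof (subst e_def, rule spectral_norm_diagonal_on_le[OF B err])
    fix b assume b: "b \<in> B"
    have "\<bar>heron (c b) (sqrt \<alpha>) (Suc k) - sqrt (c b)\<bar> \<le> \<bar>heron (c b) (sqrt \<alpha>) k - sqrt (c b)\<bar> / 2"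
      using c \<open>\<alpha> > 0\<close> that by (intro heron_error_half) auto
    with e[OF b, of k] show "\<bar>heron (c b) (sqrt \<alpha>) (Suc k) - sqrt (c b)\<bar> \<le> 1 / 2 * e k"
      by simp
  qed
  \<comment> \<open>Halving is available only from index 1 on, so the decay is anchored at
    \<open>e 1\<close> and the sequence is shifted by one.\<close>
  have geometric: "e (Suc k) \<le> (1/2) ^ k * e 1" for k
  proof (induction k)
    case (Suc k)
    then show ?case
      using half[of "Suc k"] by simp
  qed simp
  have "(\<lambda>k. (1/2) ^ k * e 1) \<longlonglongrightarrow> 0"
    by (intro tendsto_mult_left_zero LIMSEQ_power_zero) simp
  then have "(\<lambda>k. e (Suc k)) \<longlonglongrightarrow> 0"
    by (rule Lim_null_comparison[rotated])
      (use geometric in \<open>simp add: e_def spectral_norm_nonneg\<close>)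
  then have "e \<longlonglongrightarrow> 0"
    by (rule LIMSEQ_imp_Suc)
  then have "X \<longlonglongrightarrow> S"
    unfolding e_def by (rule tendsto_of_spectral_norm)
  moreover have "\<forall>\<^sub>F k in sequentially. e (Suc k) \<le> 1 / (2 * s) * (e k)\<^sup>2"
    using quad eventually_ge_at_top by (rule eventually_mono[rotated])
  ultimately have "converges_quadratically X S"
    unfolding converges_quadratically_def e_def by blast
  moreover have "invertible (X k)" for k
    unfolding X_def by (rule sqrt_iter_diagonal_on(2)[OF B K \<open>\<alpha> > 0\<close>])
  ultimately show ?thesis
    using quad half unfolding e_def s_def by simp
qed

end
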